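(* Let $(s_n)_{n\ge 1}$ be the sequence given by $s_1=3$, $s_{n+1}=6s_n^2-8s_n+3$. Then for every $n$, a particle (with the single-wall bomb) starting with slope $s_n$ at any point in the interior of the triangle with vertices $(0,0)$, $(0,1)$, $(\frac{1}{s_n},1)$, or at $(0,y)$ for some $0<y<1$, produces a periodic tunnel up and to the right.
   Context: Dynamics (single-wall bomb). The plane is covered by the unit square grid. The walls are the unit-length edges joining adjacent points of $\mathbb{Z}^2$ (each horizontal or vertical); the corners are the points of $\mathbb{Z}^2$. Initially every wall is solid. A particle starts at a given point; "slope $s$" (with $s>0$) means its initial direction is $(1,s)/\sqrt{1+s^2}$, up and to the right (if the particle starts on a wall, as at $(0,y)$, that wall is solid and being on it at time $0$ is not a collision). It moves in a straight line until it collides with a solid wall; it then reflects off, preserving the angle of incidence, and the wall hit is permanently erased. It passes freely through erased walls. If it reaches a corner it stops (whether or not the adjacent walls have been erased). Tunnels. A band is the set of points of the plane within a given finite distance of some ray $\ell$. A particle tunnels if it runs infinitely (without hitting a corner) and, for some $r$, every wall it collides with outside a disc of radius $r$ is contained in a finite union of bands. The tunnel is periodic if, for sufficiently large $r$, there is a positive integer $k$ such that (for collisions outside the disc) the wall hit in collision $m+k$ is always of the same type (horizontal/vertical) as the wall hit in collision $m$, and the displacement from the wall hit in collision $m$ to that hit in collision $m+k$ depends only on which band contains the wall hit in collision $m$. "Up and to the right" means that the collisions are contained, outside a disc, in one band whose ray has direction with both coordinates positive. *)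

theory Defs
  imports "HOL-Analysis.Analysis"
begin

type_synonym point = "real \<times> real"

(* Horizontal i j is the edge from (i,j) to (i+1,j), Vertical i j the edge from (i,j) to (i,j+1). *)
datatype wall = is_horizontal: Horizontal (col: int) (row: int) | Vertical (col: int) (row: int)

fun edge :: "wall \<Rightarrow> point set" where
  "edge (Horizontal i j) = closed_segment (of_int i, of_int j) (of_int i + 1, of_int j)"
| "edge (Vertical i j) = closed_segment (of_int i, of_int j) (of_int i, of_int j + 1)"

definition corners :: "point set" where
  "corners = \<int> \<times> \<int>"

fun reflect :: "wall \<Rightarrow> point \<Rightarrow> point" where
  "reflect (Horizontal i j) (vx, vy) = (vx, - vy)"
| "reflect (Vertical i j) (vx, vy) = (- vx, vy)"

definition slope_direction :: "real \<Rightarrow> point" where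
  "slope_direction s = (1 / sqrt (1 + s\<^sup>2)) *\<^sub>R (1, s)"

(* A particle leaving p with velocity v, when exactly the walls in E have been erased, next
   collides with w, at the point q, having met no corner on the way. Only times t > 0 count, so
   a wall on which the particle starts is not hit at time 0. *)
definition next_collision :: "wall set \<Rightarrow> point \<Rightarrow> point \<Rightarrow> wall \<Rightarrow> point \<Rightarrow> bool" where
  "next_collision E p v w q \<longleftrightarrow>
     (\<exists>t>0. q = p + t *\<^sub>R v \<and> w \<notin> E \<and> q \<in> edge w \<and>
       (\<forall>t'\<in>{0..t}. p + t' *\<^sub>R v \<notin> corners) \<and>
       (\<forall>t'. 0 < t' \<and> t' < t \<longrightarrow> (\<forall>w'. w' \<notin> E \<longrightarrow> p + t' *\<^sub>R v \<notin> edge w')))"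

(* The particle started at p with initial velocity v runs infinitely; its m-th collision
   (m = 0, 1, ...) is with the wall W m at the point X m. At every moment only finitely many walls
   have been erased, so a particle that never reaches a corner collides infinitely often. *)
definition infinite_run :: "point \<Rightarrow> point \<Rightarrow> (nat \<Rightarrow> wall) \<Rightarrow> (nat \<Rightarrow> point) \<Rightarrow> bool" where
  "infinite_run p v W X \<longleftrightarrow>
     (\<exists>V. V 0 = v \<and> next_collision {} p v (W 0) (X 0) \<and>
       (\<forall>m. V (Suc m) = reflect (W m) (V m) \<and>
            next_collision (W ` {..m}) (X m) (V (Suc m)) (W (Suc m)) (X (Suc m))))"

definition ray :: "point \<Rightarrow> point \<Rightarrow> point set" where
  "ray a d = {a + t *\<^sub>R d |t. 0 \<le> t}"

definition band :: "point \<Rightarrow> point \<Rightarrow> real \<Rightarrow> point set" where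
  "band a d \<rho> = {x. infdist x (ray a d) \<le> \<rho>}"

definition is_band :: "point set \<Rightarrow> bool" where
  "is_band B \<longleftrightarrow> (\<exists>a d \<rho>. d \<noteq> 0 \<and> 0 \<le> \<rho> \<and> B = band a d \<rho>)"

(* Discs are centred at the origin; only their being large matters below. *)
definition tunnel :: "(nat \<Rightarrow> wall) \<Rightarrow> (nat \<Rightarrow> point) \<Rightarrow> point set set \<Rightarrow> bool" where
  "tunnel W X \<B> \<longleftrightarrow> finite \<B> \<and> (\<forall>B\<in>\<B>. is_band B) \<and>
     (\<exists>r. \<forall>m. X m \<notin> cball 0 r \<longrightarrow> edge (W m) \<subseteq> \<Union>\<B>)"

definition displacement :: "wall \<Rightarrow> wall \<Rightarrow> int \<times> int" where
  "displacement w w' = (col w' - col w, row w' - row w)"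

definition periodic_tunnel :: "(nat \<Rightarrow> wall) \<Rightarrow> (nat \<Rightarrow> point) \<Rightarrow> point set set \<Rightarrow> bool" where
  "periodic_tunnel W X \<B> \<longleftrightarrow> tunnel W X \<B> \<and>
     (\<forall>\<^sub>F r in at_top. \<exists>k>0. \<exists>D. \<forall>m. X m \<notin> cball 0 r \<longrightarrow>
        (is_horizontal (W (m + k)) \<longleftrightarrow> is_horizontal (W m)) \<and>
        (\<exists>B\<in>\<B>. edge (W m) \<subseteq> B) \<and>
        (\<forall>B\<in>\<B>. edge (W m) \<subseteq> B \<longrightarrow> displacement (W m) (W (m + k)) = D B))"

definition up_right_family :: "point set set \<Rightarrow> bool" where
  "up_right_family \<B> \<longleftrightarrow> (\<exists>a d \<rho>. 0 < fst d \<and> 0 < snd d \<and> 0 \<le> \<rho> \<and> \<B> = {band a d \<rho>})"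

definition produces_periodic_tunnel_up_right :: "point \<Rightarrow> point \<Rightarrow> bool" where
  "produces_periodic_tunnel_up_right p v \<longleftrightarrow>
     (\<exists>W X \<B>. infinite_run p v W X \<and> periodic_tunnel W X \<B> \<and> up_right_family \<B>)"

end

theory Submission
  imports Defs
begin

text \<open>
  Extended backwards, the trajectory starts at \<open>(0, u)\<close> with \<open>0 < u < 1\<close>. Confined to the column
  between \<open>x = 0\<close> and \<open>x = 1\<close>, the particle zigzags between the ends of a growing vertical shaft and
  erases the horizontal walls at heights 1, 0, 2, -1, 3, ...; the wall number \<open>j\<close> is reached after
  the vertical distance \<open>j (j + 1) / 2 + 1\<close>, measured from height 0. The slope being an integer
  \<open>s\<close>, the particle meets the sides of the column at the vertical distances \<open>s + u\<close>, \<open>2 s + u\<close>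
  and \<open>3 s + u\<close>. If \<open>s = 2 a\<^sup>2 + 1\<close>, it hits the right side at \<open>(1, 1 + u)\<close>, and if also
  \<open>3 s = 2 b\<^sup>2 + 1\<close>, it returns to this point, moving upwards, after the left side has been hit
  once. It then leaves through the erased wall into the next column, in the initial situation shifted
  by \<open>(1, 1)\<close>. The two conditions amount to the Pell equation \<open>b\<^sup>2 - 3 a\<^sup>2 = 1\<close>.
\<close>

section \<open>Walls as point sets and collisions along a line\<close>

lemma mem_edge_Horizontal:
  "(x, y) \<in> edge (Horizontal i j) \<longleftrightarrow> y = of_int j \<and> of_int i \<le> x \<and> x \<le> of_int i + 1"
  by (simp add: closed_segment_same_snd) (auto simp: closed_segment_eq_real_ivl)

lemma mem_edge_Vertical:
  "(x, y) \<in> edge (Vertical i j) \<longleftrightarrow> x = of_int i \<and> of_int j \<le> y \<and> y \<le> of_int j + 1"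
  by (simp add: closed_segment_same_fst) (auto simp: closed_segment_eq_real_ivl)

declare edge.simps [simp del]

lemma notin_edge_inside_column:
  assumes "of_int i < x" "x < of_int i + 1"
    and "\<And>j. y = of_int j \<Longrightarrow> Horizontal i j \<in> E" and "w \<notin> E"
  shows "(x, y) \<notin> edge w"
proof (cases w)
  case (Horizontal i' j')
  show ?thesis
  proof
    assume "(x, y) \<in> edge w"
    hence *: "y = of_int j'" "of_int i' \<le> x" "x \<le> of_int i' + 1"
      unfolding Horizontal mem_edge_Horizontal by auto
    have "i' = i" using *(2,3) assms(1,2) by linarith
    thus False using assms(3)[OF *(1)] assms(4) Horizontal by simp
  qed
next
  case (Vertical i' j')
  have "x \<noteq> of_int i'" using assms(1,2) by (cases "i' \<le> i") auto
  thus ?thesis unfolding Vertical mem_edge_Vertical by simp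
qed

lemma notin_edge_Vertical_erased:
  assumes "of_int j < y" "y < of_int j + 1" "Vertical i j \<in> E" "w \<notin> E"
  shows "(of_int i, y) \<notin> edge w"
proof (cases w)
  case (Horizontal i' j')
  have "y \<noteq> of_int j'" using assms(1,2) by (cases "j' \<le> j") auto
  thus ?thesis unfolding Horizontal mem_edge_Horizontal by simp
next
  case (Vertical i' j')
  show ?thesis
  proof
    assume "(of_int i, y) \<in> edge w"
    hence *: "i' = i" "of_int j' \<le> y" "y \<le> of_int j' + 1"
      unfolding Vertical mem_edge_Vertical by auto
    have "j' = j" using *(2,3) assms(1,2) by linarith
    thus False using *(1) assms(3,4) Vertical by simp
  qed
qed

text \<open>The speed only rescales time. This lets the proof compute with velocities whose
  coordinates are \<open>\<plusminus>1\<close> and \<open>\<plusminus>s\<close> instead of the unit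
  vector of \<open>slope_direction\<close>.\<close>

lemma next_collision_scaleR_I:
  assumes "0 < c" "0 < \<delta>" "q = p + \<delta> *\<^sub>R v" "w \<notin> E" "q \<in> edge w"
    and "\<And>\<tau>. 0 \<le> \<tau> \<Longrightarrow> \<tau> \<le> \<delta> \<Longrightarrow> p + \<tau> *\<^sub>R v \<notin> corners"
    and "\<And>\<tau> w'. 0 < \<tau> \<Longrightarrow> \<tau> < \<delta> \<Longrightarrow> w' \<notin> E \<Longrightarrow> p + \<tau> *\<^sub>R v \<notin> edge w'"
  shows "next_collision E p (c *\<^sub>R v) w q"
  unfolding next_collision_def
proof (intro exI[of _ "\<delta> / c"] conjI ballI allI impI)
  fix t' assume "t' \<in> {0..\<delta> / c}"
  thus "p + t' *\<^sub>R c *\<^sub>R v \<notin> corners"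
    using assms(1) assms(6)[of "t' * c"] by (auto simp: field_simps)
next
  fix t' w' assume "0 < t' \<and> t' < \<delta> / c" "w' \<notin> E"
  thus "p + t' *\<^sub>R c *\<^sub>R v \<notin> edge w'"
    using assms(1) assms(7)[of "t' * c"] by (auto simp: field_simps)
qed (use assms in auto)

section \<open>Arithmetic of the zigzag in a growing shaft\<close>

primrec travel :: "nat \<Rightarrow> nat" where
  "travel 0 = 1"
| "travel (Suc j) = travel j + Suc j"

definition height :: "nat \<Rightarrow> int" where
  "height j = (if even j then 1 + int (j div 2) else - int (j div 2))"

text \<open>Vertical direction just after horizontal wall \<open>j\<close> is hit: the even-numbered
  walls are the tops of the shaft.\<close>

definition sg :: "nat \<Rightarrow> int" where
  "sg j = (if even j then - 1 else 1)"

lemma double_travel: "2 * travel j = j * (j + 1) + 2"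
  by (induction j) auto

lemma travel_even: "travel (2 * q) = 1 + q * (2 * q + 1)"
  using double_travel[of "2 * q"] by (simp add: algebra_simps)

lemma travel_odd: "travel (2 * q + 1) = 2 + q * (2 * q + 3)"
  using double_travel[of "2 * q + 1"] by (simp add: algebra_simps)

lemma strict_mono_travel: "strict_mono travel"
  by (rule strict_monoI_Suc) simp

lemma travel_le_iff: "travel i \<le> travel j \<longleftrightarrow> i \<le> j"
  by (rule strict_mono_less_eq[OF strict_mono_travel])

lemma travel_less_iff: "travel i < travel j \<longleftrightarrow> i < j"
  by (rule strict_mono_less[OF strict_mono_travel])

lemma height_Suc: "height (Suc j) = height j + sg j * int (Suc j)"
  by (cases "even j") (auto simp: height_def sg_def elim!: evenE oddE)

lemma sg_Suc: "sg (Suc j) = - sg j"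
  by (simp add: sg_def)

lemma inj_height: "inj height"
proof (rule injI)
  fix i j assume "height i = height j"
  thus "i = j" by (cases "even i"; cases "even j") (auto simp: height_def elim!: evenE oddE)
qed

lemma abs_height_le: "\<bar>height j\<bar> \<le> int j + 1"
  by (auto simp: height_def)

text \<open>The tops hit so far are 1, 2, ... and the bottoms 0, -1, ..., without gaps, so a
  crossing to the next end of the shaft passes only rows that are already erased.\<close>

lemma height_between:
  assumes "min (height j) (height (Suc j)) < z" "z < max (height j) (height (Suc j))"
  shows "\<exists>l\<le>j. z = height l"
proof (cases "z \<ge> 1")
  case True
  \<comment> \<open>The positive heights are the tops, with even numbers; the others are the
    bottoms, with odd numbers.\<close>
  have "z = height (2 * nat (z - 1))" using True by (simp add: height_def)
  moreover have "2 * nat (z - 1) \<le> j"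
    using assms True by (cases "even j") (auto simp: height_def elim!: evenE oddE)
  ultimately show ?thesis by blast
next
  case False
  have "z = height (2 * nat (- z) + 1)" using False by (simp add: height_def)
  moreover have "2 * nat (- z) + 1 \<le> j"
    using assms False by (cases "even j") (auto simp: height_def elim!: evenE oddE)
  ultimately show ?thesis by blast
qed

text \<open>Relative height at vertical distance \<open>d\<close> when the last horizontal wall hit is number \<open>j\<close>.\<close>

definition ypos :: "nat \<Rightarrow> real \<Rightarrow> real" where
  "ypos j d = of_int (height j) + of_int (sg j) * (d - real (travel j))"

lemma ypos_travel: "ypos j (real (travel j)) = of_int (height j)"
  by (simp add: ypos_def)

lemma ypos_travel_Suc: "ypos j (real (travel (Suc j))) = of_int (height (Suc j))"
  by (simp add: ypos_def height_Suc)

lemma ypos_integer: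
  assumes "real (travel j) < d" "d < real (travel (Suc j))" "ypos j d = of_int z"
  shows "\<exists>l\<le>j. z = height l"
proof (rule height_between)
  have "real_of_int (min (height j) (height (Suc j))) < of_int z
      \<and> real_of_int z < of_int (max (height j) (height (Suc j)))"
    using assms by (cases "even j") (auto simp: ypos_def sg_def height_Suc min_def max_def)
  thus "min (height j) (height (Suc j)) < z" "z < max (height j) (height (Suc j))" by linarith+
qed

text \<open>\<open>L\<close> is the number of the last horizontal wall hit before the vertical wall on the left.\<close>

locale tunnel_run =
  fixes a b s L :: nat and u :: real
  assumes s_a: "s = 2 * a\<^sup>2 + 1" and s_b: "3 * s = 2 * b\<^sup>2 + 1" and s_mod: "s mod 5 = 3"
    and L_le: "travel L \<le> 2 * s" and L_less: "2 * s < travel (Suc L)"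
    and u_pos: "0 < u" and u_less: "u < 1"
begin

section \<open>Numerical consequences of the Pell conditions\<close>

lemma a_pos: "a \<ge> 1"
  using s_a s_mod by (cases "a = 0") auto

lemma s_ge_3: "s \<ge> 3"
  using s_a a_pos by (cases a) (auto simp: power2_eq_square)

text \<open>Vertical distance \<open>s\<close> is the exact middle of the upward crossing from wall
  \<open>2 * a - 1\<close> at height \<open>1 - a\<close> to wall \<open>2 * a\<close> at height
  \<open>1 + a\<close>. The height is 1 there, and \<open>1 + u\<close> at distance
  \<open>s + u\<close>.\<close>

lemma travel_2a: "travel (2 * a) = s + a" "travel (2 * a - 1) + a = s"
proof -
  show *: "travel (2 * a) = s + a"
    unfolding travel_even s_a by (simp add: algebra_simps power2_eq_square)
  obtain a' where "a = Suc a'" using a_pos by (cases a) auto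
  thus "travel (2 * a - 1) + a = s" using * by simp
qed

text \<open>Ensures that the last crossing of the period, which starts at distance
  \<open>3 * s - b\<close>, begins after the left side is hit at \<open>2 * s + u\<close>.\<close>

lemma b_less: "b < s"
proof -
  have "b\<^sup>2 = 3 * a\<^sup>2 + 1" using s_a s_b by simp
  also have "\<dots> < (2 * a\<^sup>2 + 1) * (2 * a\<^sup>2 + 1)"
    using a_pos by (simp add: algebra_simps)
  also have "\<dots> = s\<^sup>2" by (simp add: s_a power2_eq_square)
  finally show ?thesis by (rule power_less_imp_less_base) simp
qed

lemma b_pos: "b \<ge> 1"
  using s_b s_ge_3 by (cases "b = 0") auto

lemma travel_2b: "travel (2 * b - 1) + b = 3 * s"
proof -
  obtain b' where b': "b = Suc b'" using b_pos by (cases b) auto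
  have "travel (2 * b) = 3 * s + b"
    unfolding travel_even s_b by (simp add: algebra_simps power2_eq_square)
  thus ?thesis using b' by simp
qed

text \<open>Fixes the order of events: wall \<open>2 * a\<close>, the first one after the right
  side, is reached at distance \<open>s + a \<le> 2 * s\<close>, hence before the left side.\<close>

lemma L_ge: "2 * a \<le> L"
proof -
  have "a \<le> a * a" using a_pos by (cases a) auto
  hence "a \<le> s" unfolding s_a power2_eq_square by linarith
  hence "travel (2 * a) < travel (Suc L)" using L_less travel_2a(1) by linarith
  thus ?thesis by (simp only: travel_less_iff less_Suc_eq_le)
qed

lemma L_less_2b: "L < 2 * b - 1"
  using travel_2b b_less L_le travel_less_iff[of L "2 * b - 1"] by linarith

text \<open>Row, relative to the period, of the wall hit on the left at distance
  \<open>2 * s + u\<close>. For even \<open>L\<close> the particle descends, so \<open>u\<close> is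
  subtracted from an integer height and the wall is the one below that integer.\<close>

definition row2 :: int where
  "row2 = (if even L then height L - (2 * int s - int (travel L)) - 1
           else height L + (2 * int s - int (travel L)))"

text \<open>Otherwise the wall hit on the left would already have been erased one period before, as the
  right wall of the previous column. It would make \<open>s\<close> a perfect square, but 3 is not a square
  modulo 5.\<close>

lemma row2_nonzero: "row2 \<noteq> 0"
proof (cases "even L")
  case True
  then obtain q where q: "L = 2 * q" by (elim evenE)
  show ?thesis
  proof
    assume "row2 = 0"
    hence "height L - (2 * int s - int (travel L)) = 1" using True by (simp add: row2_def)
    \<comment> \<open>For even \<open>L\<close> parity suffices: the left side is even, the right
      side odd.\<close>
    hence "int (2 * q\<^sup>2 + 2 * q) = int (4 * a\<^sup>2 + 1)"
      unfolding q travel_even s_a by (simp add: height_def power2_eq_square algebra_simps)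
    hence "2 * q\<^sup>2 + 2 * q = 4 * a\<^sup>2 + 1" by (simp only: of_nat_eq_iff)
    thus False by presburger
  qed
next
  case False
  then obtain q where q: "L = 2 * q + 1" by (elim oddE)
  show ?thesis
  proof
    assume "row2 = 0"
    hence "height L + (2 * int s - int (travel L)) = 0" using False by (simp add: row2_def)
    hence "int (2 * (q + 1)\<^sup>2) = int (2 * s)"
      unfolding q travel_odd by (simp add: height_def power2_eq_square algebra_simps)
    hence "(q + 1)\<^sup>2 = s" by (simp only: of_nat_eq_iff)
    hence "((q + 1) mod 5)\<^sup>2 mod 5 = 3" using s_mod by (simp add: power_mod)
    moreover have "(q + 1) mod 5 \<in> {0, 1, 2, 3, 4}" by auto
    ultimately show False by (auto simp: power2_eq_square)
  qed
qed


section \<open>Schedule and positions of the collisions in one period\<close>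

declare travel.simps(2) [simp del]

text \<open>
  The collisions of one period are numbered by \<open>i < 2 * b + 2\<close>; those with vertical walls are
  \<open>i = 2 * a\<close> and \<open>i = L + 2\<close>. The crossing before collision \<open>i\<close> is \<open>leg i\<close>, and \<open>vel i\<close> below is
  the velocity before it, up to a positive factor.
\<close>

definition last_hit :: "nat \<Rightarrow> nat" where
  "last_hit i = (if i < 2 * a then i else if i < L + 2 then i - 1 else i - 2)"

definition dst :: "nat \<Rightarrow> real" where
  "dst i = (if i = 2 * a then real s + u else if i = L + 2 then 2 * real s + u
            else real (travel (last_hit i)))"

definition leg :: "nat \<Rightarrow> nat" where
  "leg i = (if i \<le> 2 * a then 0 else if i \<le> L + 2 then 1 else 2)"

text \<open>Without reflections the horizontal position would be \<open>(d - u) / s\<close>; this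
  folds it back into the column, where crossing 1 runs from right to left.\<close>

definition xpos :: "nat \<Rightarrow> real \<Rightarrow> real" where
  "xpos g d = (if g = 1 then 2 - (d - u) / real s else (d - u) / real s - real g)"

definition xsg :: "nat \<Rightarrow> real" where
  "xsg g = (if g = 1 then - 1 else 1)"

definition pos :: "nat \<Rightarrow> nat \<Rightarrow> point" where
  "pos m i = (real m + xpos (leg i) (dst i), real m + ypos (last_hit i) (dst i))"

definition hit_wall :: "nat \<Rightarrow> nat \<Rightarrow> wall" where
  "hit_wall m i = (if i = 2 * a then Vertical (int m + 1) (int m + 1)
                   else if i = L + 2 then Vertical (int m) (int m + row2)
                   else Horizontal (int m) (int m + height (last_hit i)))"

text \<open>Between consecutive collisions the vertical distance stays within one crossing of the
  shaft and one crossing of the column, so a single branch of \<open>ypos\<close> and of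
  \<open>xpos\<close> describes the whole flight.\<close>

lemma step_bounds:
  assumes "Suc i < 2 * b + 2"
  shows "dst i < dst (Suc i) \<and> real (travel (last_hit i)) \<le> dst i
     \<and> dst (Suc i) \<le> real (travel (Suc (last_hit i)))
     \<and> real (leg (Suc i)) * real s + u \<le> dst i
     \<and> dst (Suc i) \<le> (real (leg (Suc i)) + 1) * real s + u"
proof -
  have mono: "real (travel j) \<le> real (travel k)" if "j \<le> k" for j k
    using that by (simp add: travel_le_iff)
  have mono': "real (travel j) < real (travel k)" if "j < k" for j k
    using that by (simp add: travel_less_iff)
  have t2a: "real (travel (2 * a)) = real s + real a" "real (travel (2 * a - 1)) = real s - real a"
    using travel_2a by linarith+
  have t2b: "real (travel (2 * b - 1)) = 3 * real s - real b" using travel_2b by linarith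
  have tL: "real (travel L) \<le> 2 * real s" "real (travel (Suc L)) \<ge> 2 * real s + 1"
    using L_le L_less by linarith+
  have ge1: "real (travel j) \<ge> 1" for j using mono[of 0 j] by simp
  have a1: "real a \<ge> 1" using a_pos by simp
  \<comment> \<open>In chronological order: the right wall is still ahead, comes next, has just been
    hit; the same for the left wall; the rest of the period.\<close>
  consider "Suc i < 2 * a" | "Suc i = 2 * a" | "i = 2 * a" | "2 * a < i" "Suc i < L + 2"
    | "2 * a < i" "Suc i = L + 2" | "i = L + 2" | "L + 2 < i"
    by linarith
  thus ?thesis
  proof cases
    case 1
    hence i: "i < 2 * a" "i \<noteq> L + 2" "Suc i \<noteq> L + 2" "Suc i \<le> 2 * a - 1" using L_ge by auto
    have e: "dst i = real (travel i)" "last_hit i = i"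
      "dst (Suc i) = real (travel (Suc i))" "real (leg (Suc i)) = 0"
      using i 1 by (auto simp: dst_def leg_def last_hit_def)
    show ?thesis unfolding e distrib_right mult_1_left mult_zero_left
      using mono[OF i(4)] mono'[OF lessI[of i]] u_pos u_less a1 t2a(2) ge1[of i]
      by - (intro conjI; linarith)
  next
    case 2
    hence i: "i = 2 * a - 1" "i < 2 * a" "i \<noteq> L + 2" using L_ge by auto
    have e: "dst i = real s - real a" "last_hit i = i" "dst (Suc i) = real s + u"
      "real (leg (Suc i)) = 0" "real (travel i) = real s - real a"
      "real (travel (Suc i)) = real s + real a"
      using t2a i 2 by (auto simp: dst_def leg_def last_hit_def)
    show ?thesis unfolding e distrib_right mult_1_left mult_zero_left using u_pos u_less a1 ge1[of i] e(5) by - (intro conjI; linarith)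
  next
    case 3
    have e: "dst i = real s + u" "last_hit i = 2 * a - 1" "dst (Suc i) = real (travel (2 * a))"
      "real (leg (Suc i)) = 1" "Suc (2 * a - 1) = 2 * a"
      using L_ge a_pos 3 by (auto simp: dst_def leg_def last_hit_def)
    show ?thesis unfolding e t2a distrib_right mult_1_left mult_zero_left using u_pos u_less a1 tL(1) t2a(1) mono[OF L_ge]
      by - (intro conjI; linarith)
  next
    case 4
    hence i: "2 * a \<le> i - 1" "i - 1 < i" "i \<le> L" by auto
    have e: "dst i = real (travel (i - 1))" "last_hit i = i - 1" "dst (Suc i) = real (travel i)"
      "real (leg (Suc i)) = 1" "Suc (i - 1) = i"
      using 4 by (auto simp: dst_def leg_def last_hit_def)
    show ?thesis unfolding e distrib_right mult_1_left mult_zero_left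
      using mono[OF i(1)] mono'[OF i(2)] mono[OF i(3)] u_pos u_less a1 t2a(1) tL(1)
      by - (intro conjI; linarith)
  next
    case 5
    have e: "dst i = real (travel L)" "last_hit i = L" "dst (Suc i) = 2 * real s + u"
      "real (leg (Suc i)) = 1"
      using 5 by (auto simp: dst_def leg_def last_hit_def)
    show ?thesis unfolding e distrib_right mult_1_left mult_zero_left using mono[OF L_ge] u_pos u_less a1 t2a(1) tL
      by - (intro conjI; linarith)
  next
    case 6
    have e: "dst i = 2 * real s + u" "last_hit i = L" "dst (Suc i) = real (travel (Suc L))"
      "real (leg (Suc i)) = 2"
      using 6 L_ge by (auto simp: dst_def leg_def last_hit_def)
    have "Suc L \<le> 2 * b - 1" using L_less_2b by simp
    from mono[OF this] show ?thesis unfolding e distrib_right mult_1_left mult_zero_left using u_pos u_less t2b tL by - (intro conjI; linarith)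
  next
    case 7
    hence i: "Suc L \<le> i - 2" "i - 2 < i - 1" "i - 1 \<le> 2 * b - 1" using assms by auto
    have e: "dst i = real (travel (i - 2))" "last_hit i = i - 2" "dst (Suc i) = real (travel (i - 1))"
      "real (leg (Suc i)) = 2" "Suc (i - 2) = i - 1"
      using 7 L_ge by (auto simp: dst_def leg_def last_hit_def)
    show ?thesis unfolding e distrib_right mult_1_left mult_zero_left
      using mono[OF i(1)] mono'[OF i(2)] mono[OF i(3)] u_pos u_less t2b tL
      by - (intro conjI; linarith)
  qed
qed

lemma real_s_pos: "real s > 0"
  using s_ge_3 by linarith

text \<open>The crossing changes only at a vertical wall, where the two folded formulas agree. Thus
  the end of one flight can be read as the start of the next.\<close>

lemma xpos_leg_Suc: "xpos (leg (Suc i)) (dst i) = xpos (leg i) (dst i)"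
proof -
  have "leg (Suc i) = leg i" if "i \<noteq> 2 * a" "i \<noteq> L + 2" using that by (auto simp: leg_def)
  thus ?thesis using L_ge real_s_pos
    by (cases "i = 2 * a"; cases "i = L + 2") (auto simp: leg_def dst_def xpos_def field_simps)
qed

lemma last_hit_Suc:
  "last_hit (Suc i) = (if Suc i = 2 * a \<or> Suc i = L + 2 then last_hit i else Suc (last_hit i))"
  using L_ge a_pos by (auto simp: last_hit_def)

lemma ypos_last_hit_Suc: "ypos (last_hit i) (dst (Suc i)) = ypos (last_hit (Suc i)) (dst (Suc i))"
proof (cases "Suc i = 2 * a \<or> Suc i = L + 2")
  case True
  thus ?thesis by (simp add: last_hit_Suc)
next
  case False
  thus ?thesis by (simp add: dst_def last_hit_Suc ypos_travel ypos_travel_Suc)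
qed

lemma pos_eq: "pos m i = (real m + xpos (leg (Suc i)) (dst i), real m + ypos (last_hit i) (dst i))"
  by (simp add: pos_def xpos_leg_Suc)

lemma pos_Suc:
  "pos m (Suc i) = (real m + xpos (leg (Suc i)) (dst (Suc i)), real m + ypos (last_hit i) (dst (Suc i)))"
  by (simp add: pos_def ypos_last_hit_Suc)

lemma xpos_strict:
  assumes "g \<le> 2" "real g * real s + u < d" "d < (real g + 1) * real s + u"
  shows "0 < xpos g d" "xpos g d < 1"
proof -
  have "real g < (d - u) / real s" "(d - u) / real s < real g + 1"
    using assms real_s_pos by (simp_all add: field_simps)
  thus "0 < xpos g d" "xpos g d < 1" by (cases "g = 1"; simp add: xpos_def)+
qed

lemma xpos_bounds:
  assumes "g \<le> 2" "real g * real s + u \<le> d" "d \<le> (real g + 1) * real s + u"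
  shows "0 \<le> xpos g d" "xpos g d \<le> 1"
proof -
  have "real g \<le> (d - u) / real s" "(d - u) / real s \<le> real g + 1"
    using assms real_s_pos by (simp_all add: field_simps)
  thus "0 \<le> xpos g d" "xpos g d \<le> 1" by (cases "g = 1"; simp add: xpos_def)+
qed

text \<open>The slope is an integer, so at a corner the distances travelled since the start and since
  the last vertical wall would both be integers.\<close>

lemma not_corner: "(real m + xpos g d, real n + ypos j d) \<notin> corners"
proof
  assume "(real m + xpos g d, real n + ypos j d) \<in> corners"
  hence x: "real m + xpos g d \<in> \<int>" and y: "real n + ypos j d \<in> \<int>" by (auto simp: corners_def)
  have "(d - u) / real s \<in> \<int>"
  proof (cases "g = 1")
    case True
    hence "(d - u) / real s = of_int (int m + 2) - (real m + xpos g d)" by (simp add: xpos_def)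
    thus ?thesis using x by (metis Ints_diff Ints_of_int)
  next
    case False
    hence "(d - u) / real s = (real m + xpos g d) + of_int (int g - int m)" by (simp add: xpos_def)
    thus ?thesis using x by (metis Ints_add Ints_of_int)
  qed
  hence "(d - u) / real s * real s \<in> \<int>" by (intro Ints_mult) auto
  hence du: "d - u \<in> \<int>" using real_s_pos by simp
  have "real_of_int (sg j) * real_of_int (sg j) = 1" by (simp add: sg_def)
  hence "d = of_int (sg j) * ((real n + ypos j d) - of_int (int n + height j)) + real (travel j)"
    by (simp add: ypos_def flip: mult.assoc)
  moreover have "\<dots> \<in> \<int>" using y by (intro Ints_add Ints_mult Ints_diff) auto
  ultimately have "d \<in> \<int>" by simp
  hence "d - (d - u) \<in> \<int>" using du by (rule Ints_diff)
  hence "u \<in> \<int>" by simp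
  then obtain z where "u = of_int z" by (elim Ints_cases)
  thus False using u_pos u_less by simp
qed

section \<open>Single collisions: within a period, between periods, and the first\<close>

text \<open>Vertical distance replaces time as the parameter; it grows at rate \<open>s\<close>.
  Corners are excluded by \<open>not_corner\<close>, so only freedom from solid walls remains to be
  checked.\<close>

lemma flight:
  assumes "0 < c" "d0 < d1" "w \<notin> E" "(real m + xpos g d1, real m + ypos j d1) \<in> edge w"
    and free: "\<And>d w'. d0 < d \<Longrightarrow> d < d1 \<Longrightarrow> w' \<notin> E \<Longrightarrow>
      (real m + xpos g d, real m + ypos j d) \<notin> edge w'"
  shows "next_collision E (real m + xpos g d0, real m + ypos j d0)
     (c *\<^sub>R (xsg g, of_int (sg j) * real s)) w (real m + xpos g d1, real m + ypos j d1)"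
proof -
  have move: "(real m + xpos g d0, real m + ypos j d0) + \<tau> *\<^sub>R (xsg g, of_int (sg j) * real s)
      = (real m + xpos g (d0 + \<tau> * real s), real m + ypos j (d0 + \<tau> * real s))" for \<tau>
    using real_s_pos by (simp add: xpos_def xsg_def ypos_def field_simps)
  show ?thesis
  proof (rule next_collision_scaleR_I[where \<delta> = "(d1 - d0) / real s"], goal_cases)
    case 2
    thus ?case using assms(2) real_s_pos by simp
  next
    case 3
    show ?case unfolding move using real_s_pos by simp
  next
    case (6 \<tau>)
    show ?case unfolding move by (rule not_corner)
  next
    case (7 \<tau> w')
    thus ?case unfolding move using real_s_pos by (intro free) (auto simp: field_simps)
  qed (use assms in auto)
qed

lemma leg_le: "leg i \<le> 2"
  by (simp add: leg_def)

lemma free_in_column: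
  assumes "real (travel j) < d" "d < real (travel (Suc j))"
    and "g \<le> 2" "real g * real s + u < d" "d < (real g + 1) * real s + u"
    and "\<And>l. l \<le> j \<Longrightarrow> Horizontal (int m) (int m + height l) \<in> E" and "w \<notin> E"
  shows "(real m + xpos g d, real m + ypos j d) \<notin> edge w"
proof (rule notin_edge_inside_column[where i = "int m" and E = E])
  show "of_int (int m) < real m + xpos g d" "real m + xpos g d < of_int (int m) + 1"
    using xpos_strict[OF assms(3,4,5)] by auto
  fix z assume "real m + ypos j d = of_int z"
  hence "ypos j d = of_int (z - int m)" by simp
  from ypos_integer[OF assms(1,2) this] obtain l where "l \<le> j" "z = int m + height l" by auto
  thus "Horizontal (int m) z \<in> E" using assms(6) by simp
qed fact

lemma row2_bounds: "of_int row2 \<le> ypos L (2 * real s + u)" "ypos L (2 * real s + u) \<le> of_int row2 + 1"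
  using u_pos u_less by (simp_all add: row2_def ypos_def sg_def)

lemma pos_in_edge:
  assumes "i < 2 * b + 2"
  shows "pos m i \<in> edge (hit_wall m i)"
proof -
  have x: "0 \<le> xpos (leg i) (dst i)" "xpos (leg i) (dst i) \<le> 1"
  proof -
    have "real (leg i) * real s + u \<le> dst i \<and> dst i \<le> (real (leg i) + 1) * real s + u"
    proof (cases i)
      \<comment> \<open>\<open>step_bounds\<close> reaches a collision only through its predecessor;
        the first one lies at vertical distance 1.\<close>
      case 0
      thus ?thesis using a_pos u_less u_pos s_ge_3 by (simp add: leg_def dst_def last_hit_def)
    next
      case (Suc i')
      thus ?thesis using step_bounds[of i'] assms by auto
    qed
    thus "0 \<le> xpos (leg i) (dst i)" "xpos (leg i) (dst i) \<le> 1" using xpos_bounds[OF leg_le] by auto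
  qed
  consider "i = 2 * a" | "i = L + 2" "i \<noteq> 2 * a" | "i \<noteq> L + 2" "i \<noteq> 2 * a" by blast
  thus ?thesis
  proof cases
    case 1
    have y: "ypos (last_hit i) (dst i) = 1 + u"
    proof -
      obtain a' where a': "a = Suc a'" using a_pos by (cases a) auto
      have "last_hit i = 2 * a - 1" using 1 L_ge by (simp add: last_hit_def)
      hence "last_hit i = 2 * a' + 1" by (simp add: a')
      moreover have "dst i = real s + u" using 1 by (simp add: dst_def)
      moreover have "real (travel (2 * a' + 1)) + real a = real s"
        using travel_2a(2) unfolding a' by (simp flip: of_nat_add)
      ultimately show ?thesis using a' by (simp add: ypos_def height_def sg_def)
    qed
    have "xpos (leg i) (dst i) = 1" using 1 real_s_pos by (simp add: leg_def dst_def xpos_def)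
    thus ?thesis using 1 y u_pos u_less by (simp add: hit_wall_def pos_def mem_edge_Vertical)
  next
    case 2
    have "xpos (leg i) (dst i) = 0"
      using 2 real_s_pos L_ge by (simp add: leg_def dst_def xpos_def field_simps)
    moreover have "last_hit i = L" using 2 L_ge by (simp add: last_hit_def)
    ultimately show ?thesis using 2 row2_bounds
      by (simp add: hit_wall_def pos_def mem_edge_Vertical dst_def)
  next
    case 3
    thus ?thesis using x
      by (simp add: hit_wall_def pos_def mem_edge_Horizontal dst_def ypos_travel)
  qed
qed

definition vel :: "nat \<Rightarrow> point" where
  "vel i = (xsg (leg i), if i = 0 then real s else of_int (sg (last_hit (i - 1))) * real s)"

lemma collision_step:
  assumes "Suc i < 2 * b + 2" "0 < c"
    and "\<And>l. l \<le> last_hit i \<Longrightarrow> Horizontal (int m) (int m + height l) \<in> E"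
    and "hit_wall m (Suc i) \<notin> E"
  shows "next_collision E (pos m i) (c *\<^sub>R vel (Suc i)) (hit_wall m (Suc i)) (pos m (Suc i))"
proof -
  note b = step_bounds[OF assms(1)]
  have "next_collision E (real m + xpos (leg (Suc i)) (dst i), real m + ypos (last_hit i) (dst i))
     (c *\<^sub>R (xsg (leg (Suc i)), of_int (sg (last_hit i)) * real s)) (hit_wall m (Suc i))
     (real m + xpos (leg (Suc i)) (dst (Suc i)), real m + ypos (last_hit i) (dst (Suc i)))"
  proof (rule flight)
    show "(real m + xpos (leg (Suc i)) (dst (Suc i)), real m + ypos (last_hit i) (dst (Suc i)))
        \<in> edge (hit_wall m (Suc i))"
      using pos_in_edge[OF assms(1)] unfolding pos_Suc .
    fix d w assume "dst i < d" "d < dst (Suc i)" "w \<notin> E"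
    thus "(real m + xpos (leg (Suc i)) d, real m + ypos (last_hit i) d) \<notin> edge w"
      using b leg_le assms(3) by (intro free_in_column[where E = E]) auto
  qed (use b assms in auto)
  thus ?thesis unfolding pos_Suc pos_eq[of m i] vel_def by simp
qed

lemma last_hit_last: "last_hit (2 * b + 1) = 2 * b - 1"
  using L_less_2b L_ge a_pos by (simp add: last_hit_def)

text \<open>The last crossing is upward and has its middle, at height 1, at distance
  \<open>3 * s\<close>; this is the second Pell condition at work.\<close>

lemma ypos_last: "ypos (2 * b - 1) d = d - 3 * real s + 1"
proof -
  obtain b' where b': "b = Suc b'" using b_pos by (cases b) auto
  have "real (travel (2 * b' + 1)) + real b = 3 * real s"
    using travel_2b unfolding b' by (simp flip: of_nat_add)
  thus ?thesis by (simp add: b' ypos_def height_def sg_def)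
qed

text \<open>The flight into the next column. At distance \<open>3 * s + u\<close> it passes the
  point of the right side where collision \<open>2 * a\<close> took place, and at
  \<open>3 * s + 1\<close> it meets the wall at relative height 2, which is wall number 0 of the
  next period.\<close>

lemma collision_wrap:
  assumes "0 < c"
    and "\<And>l. l \<le> 2 * b - 1 \<Longrightarrow> Horizontal (int m) (int m + height l) \<in> E"
    and "Vertical (int m + 1) (int m + 1) \<in> E" "hit_wall (Suc m) 0 \<notin> E"
  shows "next_collision E (pos m (2 * b + 1)) (c *\<^sub>R vel 0) (hit_wall (Suc m) 0) (pos (Suc m) 0)"
proof -
  let ?j = "2 * b - 1"
  have leg: "leg (2 * b + 1) = 2" "leg 0 = 0" using L_less_2b L_ge by (auto simp: leg_def)
  have dst: "dst (2 * b + 1) = real (travel ?j)" "dst 0 = 1"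
    using L_less_2b L_ge a_pos last_hit_last by (auto simp: dst_def last_hit_def)
  have tj: "real (travel ?j) = 3 * real s - real b" using travel_2b by linarith
  have "travel (Suc ?j) = travel ?j + 2 * b" using b_pos by (simp only: travel.simps)
  hence tj': "real (travel (Suc ?j)) = 3 * real s + real b" using tj by linarith
  have b1: "real b \<ge> 1" "real b \<le> real s - 1" using b_pos b_less by linarith+
  have next_pos: "pos (Suc m) 0
      = (real m + xpos 2 (3 * real s + 1), real m + ypos ?j (3 * real s + 1))"
  proof -
    have "ypos ?j (3 * real s + 1) = 2" by (simp only: ypos_last)
    moreover have "ypos (last_hit 0) (dst 0) = 1" "xpos 2 (3 * real s + 1) = 1 + xpos 0 1"
      using a_pos real_s_pos unfolding dst
      by (simp_all add: last_hit_def ypos_def height_def xpos_def field_simps)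
    ultimately show ?thesis by (simp add: pos_def leg dst)
  qed
  have "next_collision E (real m + xpos 2 (real (travel ?j)), real m + ypos ?j (real (travel ?j)))
     (c *\<^sub>R (xsg 2, of_int (sg ?j) * real s)) (hit_wall (Suc m) 0)
     (real m + xpos 2 (3 * real s + 1), real m + ypos ?j (3 * real s + 1))"
  proof (rule flight)
    show "(real m + xpos 2 (3 * real s + 1), real m + ypos ?j (3 * real s + 1))
        \<in> edge (hit_wall (Suc m) 0)"
      using pos_in_edge[of 0 "Suc m"] unfolding next_pos by simp
    fix d w assume d: "real (travel ?j) < d" "d < 3 * real s + 1" and w: "w \<notin> E"
    consider "d < 3 * real s + u" | "d = 3 * real s + u" | "d > 3 * real s + u" by linarith
    thus "(real m + xpos 2 d, real m + ypos ?j d) \<notin> edge w"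
    proof cases
      case 1
      thus ?thesis using d w tj tj' b1 u_less u_pos assms(2)
        by (intro free_in_column[where E = E]) auto
    next
      case 2
      have "(of_int (int m + 1), real m + 1 + u) \<notin> edge w"
        using u_pos u_less assms(3) w
        by (intro notin_edge_Vertical_erased[where j = "int m + 1" and E = E]) auto
      moreover have "xpos 2 d = 1" using 2 real_s_pos by (simp add: xpos_def field_simps)
      moreover have "ypos ?j d = 1 + u" unfolding ypos_last using 2 by simp
      ultimately show ?thesis by (simp add: add.assoc)
    next
      case 3
      show ?thesis
      proof (rule notin_edge_inside_column[where i = "int m + 1" and E = E])
        have "3 < (d - u) / real s" using 3 real_s_pos by (simp add: field_simps)
        thus "of_int (int m + 1) < real m + xpos 2 d" by (simp add: xpos_def)
        have "d - u < 4 * real s" using d u_pos s_ge_3 by linarith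
        hence "(d - u) / real s < 4" using real_s_pos by (simp add: field_simps)
        thus "real m + xpos 2 d < of_int (int m + 1) + 1" by (simp add: xpos_def)
        \<comment> \<open>In the new column the relative height stays strictly between 1 and 2, so
          no integer height occurs and the goal holds vacuously.\<close>
        fix z assume "real m + ypos ?j d = of_int z"
        hence "of_int (int m + 1) < real_of_int z" "real_of_int z < of_int (int m + 2)"
          using 3 d u_pos unfolding ypos_last by auto
        hence "int m + 1 < z" "z < int m + 2" by linarith+
        thus "Horizontal (int m + 1) z \<in> E" by simp
      qed fact
    qed
  qed (use assms tj b1 in auto)
  moreover have "vel 0 = (xsg 2, of_int (sg ?j) * real s)"
    using b_pos leg by (simp add: vel_def xsg_def sg_def)
  ultimately show ?thesis using last_hit_last leg dst
    by (simp add: next_pos) (simp add: pos_def)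
qed

lemma collision_first:
  assumes "0 < c" "0 \<le> x0" "y0 = u + real s * x0" "y0 < 1"
  shows "next_collision {} (x0, y0) (c *\<^sub>R vel 0) (hit_wall 0 0) (pos 0 0)"
proof (rule next_collision_scaleR_I[where \<delta> = "(1 - y0) / real s"], goal_cases)
  case 2
  thus ?case using assms real_s_pos by simp
next
  case 3
  have "last_hit 0 = 0" "leg 0 = 0" "dst 0 = 1" using a_pos by (auto simp: last_hit_def leg_def dst_def)
  thus ?case using real_s_pos assms(3)
    by (simp add: pos_def vel_def xsg_def xpos_def ypos_def height_def field_simps)
next
  case 5
  show ?case by (rule pos_in_edge) simp
next
  case (6 \<tau>)
  \<comment> \<open>On the initial rise the height equals the vertical distance \<open>d\<close>.
    Since wall 1 has height 0 and is reached at distance 2, this is \<open>2 + ypos 1 d\<close>, a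
    form to which \<open>not_corner\<close> applies.\<close>
  have "(x0, y0) + \<tau> *\<^sub>R vel 0
      = (real 0 + xpos 0 (y0 + \<tau> * real s), real 2 + ypos 1 (y0 + \<tau> * real s))"
    using real_s_pos assms(3)
    by (simp add: vel_def xsg_def leg_def xpos_def ypos_def height_def sg_def travel.simps(2) field_simps)
  thus ?case by (simp only: not_corner not_False_eq_True)
next
  case (7 \<tau> w)
  have 1: "(x0, y0) + \<tau> *\<^sub>R vel 0 = (x0 + \<tau>, y0 + \<tau> * real s)"
    by (simp add: vel_def xsg_def leg_def)
  have 2: "y0 + \<tau> * real s < 1" "0 < \<tau> * real s" "real s \<ge> 3"
    using 7 real_s_pos s_ge_3 by (simp_all add: field_simps)
  have 3: "0 \<le> real s * x0" using assms(2) by simp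
  show ?case unfolding 1
  proof (rule notin_edge_inside_column[where i = 0 and E = "{}"])
    show "of_int 0 < x0 + \<tau>" using assms(2) 7 by simp
    have "(x0 + \<tau>) * real s < 1" using 2 assms(3) u_pos by (simp add: algebra_simps)
    hence "(x0 + \<tau>) * real s < 1 * real s" using 2 by linarith
    thus "x0 + \<tau> < of_int 0 + 1" using real_s_pos by (simp only: mult_less_cancel_right_pos)
    fix z assume "y0 + \<tau> * real s = of_int z"
    hence "0 < real_of_int z" "real_of_int z < 1" using 2 3 assms(3) u_pos by auto
    thus "Horizontal 0 z \<in> {}" by simp
  qed simp
qed (use assms in auto)

section \<open>Distinct collisions hit distinct walls; erased walls and reflections\<close>

lemma last_hit_inj:
  assumes "last_hit i = last_hit i'" "i \<noteq> 2 * a" "i \<noteq> L + 2" "i' \<noteq> 2 * a" "i' \<noteq> L + 2"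
  shows "i = i'"
  using assms L_ge by (auto simp: last_hit_def split: if_splits)

text \<open>Guarantees that every wall is still solid when it is due. The only conceivable
  repetition is the left wall of a column being the right wall hit one period earlier, which
  \<open>row2_nonzero\<close> excludes.\<close>

lemma hit_wall_inj:
  assumes "hit_wall m i = hit_wall m' i'"
  shows "m = m' \<and> i = i'"
  using assms row2_nonzero last_hit_inj[of i i']
  by (auto simp: hit_wall_def inj_eq[OF inj_height] split: if_splits)

lemma height_hit_before:
  assumes "l \<le> last_hit i"
  shows "\<exists>i'\<le>i. hit_wall m i' = Horizontal (int m) (int m + height l)"
proof -
  \<comment> \<open>Inverse of \<open>last_hit\<close> on horizontal collisions: the index skips the
    vertical collisions \<open>2 * a\<close> and \<open>L + 2\<close>.\<close>
  define i' where "i' = (if l < 2 * a then l else if l \<le> L then l + 1 else l + 2)"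
  have "i' \<le> i"
  proof -
    consider "i < 2 * a" | "2 * a \<le> i" "i < L + 2" | "L + 2 \<le> i" by linarith
    thus ?thesis
    proof cases
      case 1
      thus ?thesis using assms by (simp add: i'_def last_hit_def)
    next
      case 2
      hence "last_hit i + 1 = i" using a_pos by (simp add: last_hit_def)
      moreover have "last_hit i \<le> L" using 2 by (simp add: last_hit_def)
      ultimately show ?thesis using assms by (simp add: i'_def)
    next
      case 3
      hence "last_hit i + 2 = i" using L_ge by (simp add: last_hit_def)
      thus ?thesis using assms by (simp add: i'_def)
    qed
  qed
  moreover have "last_hit i' = l" "i' \<noteq> 2 * a" "i' \<noteq> L + 2"
    using L_ge by (auto simp: i'_def last_hit_def)
  ultimately show ?thesis by (auto simp: hit_wall_def)
qed

lemma reflect_vel: "reflect (hit_wall m i) (c *\<^sub>R vel i) = c *\<^sub>R vel (Suc i)"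
proof -
  consider "i = 2 * a" | "i = L + 2" "i \<noteq> 2 * a" | "i \<noteq> L + 2" "i \<noteq> 2 * a" by blast
  thus ?thesis
  proof cases
    case 1
    moreover from this have "last_hit i = last_hit (i - 1)"
      using last_hit_Suc[of "i - 1"] a_pos by simp
    ultimately show ?thesis using a_pos L_ge
      by (simp add: hit_wall_def vel_def leg_def xsg_def)
  next
    case 2
    moreover from this have "last_hit i = last_hit (i - 1)"
      using last_hit_Suc[of "i - 1"] by simp
    ultimately show ?thesis using L_ge
      by (simp add: hit_wall_def vel_def leg_def xsg_def)
  next
    case 3
    have "leg (Suc i) = leg i" using 3 by (auto simp: leg_def)
    moreover have "sg (last_hit i) = (if i = 0 then - 1 else - sg (last_hit (i - 1)))"
      using last_hit_Suc[of "i - 1"] 3 a_pos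
      by (cases i) (auto simp: sg_Suc, simp_all add: last_hit_def sg_def)
    ultimately show ?thesis using 3 by (simp add: hit_wall_def vel_def)
  qed
qed

section \<open>Assembling the infinite run\<close>

definition period :: nat where
  "period = 2 * b + 2"

definition run_wall :: "nat \<Rightarrow> wall" where
  "run_wall n = hit_wall (n div period) (n mod period)"

definition run_pos :: "nat \<Rightarrow> point" where
  "run_pos n = pos (n div period) (n mod period)"

lemma inj_run_wall: "inj run_wall"
proof (rule injI)
  fix n n' assume "run_wall n = run_wall n'"
  hence "n div period = n' div period \<and> n mod period = n' mod period"
    unfolding run_wall_def by (rule hit_wall_inj)
  thus "n = n'" by (metis div_mult_mod_eq)
qed

lemma hit_wall_erased:
  assumes "i \<le> n mod period"
  shows "hit_wall (n div period) i \<in> run_wall ` {..n}"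
proof
  have "i < period" using assms by (rule le_less_trans) (simp add: period_def)
  thus "hit_wall (n div period) i = run_wall (n div period * period + i)"
    by (simp add: run_wall_def)
  show "n div period * period + i \<in> {..n}"
    using assms by (metis add_le_cancel_left atMost_iff div_mult_mod_eq)
qed

lemma height_erased:
  assumes "l \<le> last_hit (n mod period)"
  shows "Horizontal (int (n div period)) (int (n div period) + height l) \<in> run_wall ` {..n}"
  using height_hit_before[OF assms] hit_wall_erased by metis

lemma run_step:
  assumes "0 < c"
  shows "next_collision (run_wall ` {..n}) (run_pos n) (c *\<^sub>R vel (Suc n mod period))
    (run_wall (Suc n)) (run_pos (Suc n))"
proof -
  let ?m = "n div period" and ?i = "n mod period"
  have "run_wall (Suc n) \<notin> run_wall ` {..n}"
    using inj_run_wall by (auto dest: injD)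
  moreover have "?i < period" by (simp add: period_def)
  ultimately show ?thesis
  proof (cases "Suc ?i = period")
    case False
    hence *: "Suc n mod period = Suc ?i" "Suc n div period = ?m"
      by (simp_all add: mod_Suc div_Suc)
    have "Suc ?i < 2 * b + 2" using False \<open>?i < period\<close> unfolding period_def by linarith
    thus ?thesis using \<open>run_wall (Suc n) \<notin> _\<close> assms
      unfolding run_pos_def run_wall_def[of "Suc n"] * by (intro collision_step height_erased)
  next
    case True
    hence *: "Suc n mod period = 0" "Suc n div period = Suc ?m" "?i = 2 * b + 1"
      by (simp_all add: mod_Suc div_Suc) (simp add: period_def)
    have "hit_wall ?m (2 * a) \<in> run_wall ` {..n}"
      using L_ge L_less_2b by (intro hit_wall_erased) (simp add: *(3))
    hence "Vertical (int ?m + 1) (int ?m + 1) \<in> run_wall ` {..n}" by (simp add: hit_wall_def)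
    moreover have "Horizontal (int ?m) (int ?m + height l) \<in> run_wall ` {..n}"
      if "l \<le> 2 * b - 1" for l
      using height_erased[of l n] that last_hit_last *(3) by simp
    ultimately show ?thesis using \<open>run_wall (Suc n) \<notin> _\<close> assms
      unfolding run_pos_def run_wall_def[of "Suc n"] * by (intro collision_wrap)
  qed
qed

lemma run_infinite:
  assumes "0 < c" "0 \<le> x0" "y0 = u + real s * x0" "y0 < 1"
  shows "infinite_run (x0, y0) (c *\<^sub>R (1, real s)) run_wall run_pos"
  unfolding infinite_run_def
proof (intro exI[of _ "\<lambda>n. c *\<^sub>R vel (n mod period)"] conjI allI)
  have v: "vel 0 = (1, real s)" by (simp add: vel_def leg_def xsg_def)
  show "c *\<^sub>R vel (0 mod period) = c *\<^sub>R (1, real s)" by (simp add: v)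
  show "next_collision {} (x0, y0) (c *\<^sub>R (1, real s)) (run_wall 0) (run_pos 0)"
    using collision_first[OF assms] by (simp add: run_wall_def run_pos_def v)
next
  fix n
  have "vel (Suc (n mod period)) = vel (Suc n mod period)"
  proof (cases "Suc (n mod period) = period")
    case True
    hence "vel (Suc (n mod period)) = vel (2 * b + 2)" by (simp only: period_def)
    \<comment> \<open>The velocity after the last collision is the initial one: crossing 2 runs to
      the right like crossing 0, and wall \<open>2 * b - 1\<close> is a bottom, left
      upwards.\<close>
    also have "\<dots> = vel 0"
    proof -
      have "leg (2 * b + 2) = 2" using L_less_2b L_ge by (auto simp: leg_def)
      thus ?thesis using last_hit_last b_pos by (simp add: vel_def xsg_def leg_def[of 0] sg_def)
    qed
    finally show ?thesis using True by (simp add: mod_Suc)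
  qed (simp add: mod_Suc)
  thus "c *\<^sub>R vel (Suc n mod period) = reflect (run_wall n) (c *\<^sub>R vel (n mod period))"
    by (simp only: run_wall_def reflect_vel)
  show "next_collision (run_wall ` {..n}) (run_pos n) (c *\<^sub>R vel (Suc n mod period))
    (run_wall (Suc n)) (run_pos (Suc n))"
    using assms(1) by (rule run_step)
qed

section \<open>The band and the periodicity of the tunnel\<close>

text \<open>A crude bound for the distance from the diagonal point \<open>(m, m)\<close> to the
  walls of period \<open>m\<close>: heights are at most \<open>2 * b + 2\<close> in absolute value,
  and the constant absorbs the edge lengths.\<close>

definition width :: real where
  "width = 2 * real b + \<bar>of_int row2\<bar> + 8"

lemma edge_in_band:
  assumes "i < period"
  shows "edge (hit_wall m i) \<subseteq> band (0, 0) (1, 1) width"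
proof
  fix q assume q: "q \<in> edge (hit_wall m i)"
  obtain x y where xy: "q = (x, y)" by (cases q)
  have "i \<le> 2 * b + 1" using assms by (simp add: period_def)
  moreover have "last_hit i \<le> i" by (simp add: last_hit_def)
  ultimately have h: "\<bar>real_of_int (height (last_hit i))\<bar> \<le> 2 * real b + 2"
    using abs_height_le[of "last_hit i"] by linarith
  have "\<bar>x - real m\<bar> \<le> 1 \<and> \<bar>y - real m\<bar> \<le> width - 1"
  proof (cases "hit_wall m i")
    case (Horizontal j k)
    hence "j = int m" "k = int m + height (last_hit i)"
      by (auto simp: hit_wall_def split: if_splits)
    thus ?thesis using q h unfolding xy Horizontal mem_edge_Horizontal width_def by auto
  next
    case (Vertical j k)
    hence "j = int m + 1 \<and> k = int m + 1 \<or> j = int m \<and> k = int m + row2"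
      by (auto simp: hit_wall_def split: if_splits)
    thus ?thesis using q unfolding xy Vertical mem_edge_Vertical width_def by auto
  qed
  moreover have "dist q (real m, real m) \<le> \<bar>x - real m\<bar> + \<bar>y - real m\<bar>"
    unfolding xy dist_Pair_Pair using sqrt_sum_squares_le_sum_abs by (simp add: dist_real_def)
  moreover have "(real m, real m) \<in> ray (0, 0) (1, 1)"
    unfolding ray_def by (auto intro!: exI[of _ "real m"])
  ultimately show "q \<in> band (0, 0) (1, 1) width"
    unfolding band_def using infdist_le[of "(real m, real m)" "ray (0, 0) (1, 1)" q] by simp
qed

lemma run_edge_in_band: "edge (run_wall n) \<subseteq> band (0, 0) (1, 1) width"
  unfolding run_wall_def by (rule edge_in_band) (simp add: period_def)

lemma width_nonneg: "0 \<le> width"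
  by (simp add: width_def)

lemma hit_wall_Suc:
  "is_horizontal (hit_wall (Suc m) i) = is_horizontal (hit_wall m i)"
  "displacement (hit_wall m i) (hit_wall (Suc m) i) = (1, 1)"
  by (auto simp: hit_wall_def displacement_def)

lemma run_wall_period:
  "is_horizontal (run_wall (n + period)) = is_horizontal (run_wall n)"
  "displacement (run_wall n) (run_wall (n + period)) = (1, 1)"
proof -
  have "period > 0" by (simp add: period_def)
  hence "run_wall (n + period) = hit_wall (Suc (n div period)) (n mod period)"
    by (simp add: run_wall_def)
  thus "is_horizontal (run_wall (n + period)) = is_horizontal (run_wall n)"
    "displacement (run_wall n) (run_wall (n + period)) = (1, 1)"
    unfolding run_wall_def[of n] by (simp_all add: hit_wall_Suc)
qed

lemma run_periodic_tunnel: "periodic_tunnel run_wall run_pos {band (0, 0) (1, 1) width}"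
proof -
  have "is_band (band (0, 0) (1, 1) width)"
    unfolding is_band_def using width_nonneg
    by (intro exI[of _ "(0, 0)"] exI[of _ "(1, 1)"] exI[of _ width]) (simp add: zero_prod_def)
  hence "tunnel run_wall run_pos {band (0, 0) (1, 1) width}"
    unfolding tunnel_def using run_edge_in_band by auto
  \<comment> \<open>The run is periodic from its first collision, so every radius serves.\<close>
  moreover have "\<exists>k>0. \<exists>D. \<forall>m. run_pos m \<notin> cball 0 r \<longrightarrow>
        (is_horizontal (run_wall (m + k)) \<longleftrightarrow> is_horizontal (run_wall m)) \<and>
        (\<exists>B\<in>{band (0, 0) (1, 1) width}. edge (run_wall m) \<subseteq> B) \<and>
        (\<forall>B\<in>{band (0, 0) (1, 1) width}. edge (run_wall m) \<subseteq> B \<longrightarrow>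
           displacement (run_wall m) (run_wall (m + k)) = D B)" for r
    using run_edge_in_band
    by (intro exI[of _ period] exI[of _ "\<lambda>_. (1, 1)"] conjI)
      (simp add: period_def, auto simp: run_wall_period)
  ultimately show ?thesis unfolding periodic_tunnel_def by simp
qed

lemma produces_tunnel:
  assumes "0 \<le> x0" "y0 = u + real s * x0" "y0 < 1"
  shows "produces_periodic_tunnel_up_right (x0, y0) (slope_direction (real s))"
proof -
  have "infinite_run (x0, y0) (slope_direction (real s)) run_wall run_pos"
    unfolding slope_direction_def
    using assms by (intro run_infinite) (auto intro!: divide_pos_pos real_sqrt_gt_zero add_pos_nonneg)
  moreover have "up_right_family {band (0, 0) (1, 1) width}"
    unfolding up_right_family_def
    by (intro exI[of _ "(0, 0)"] exI[of _ "(1, 1)"] exI[of _ width]) (simp add: width_nonneg)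
  ultimately show ?thesis
    using run_periodic_tunnel unfolding produces_periodic_tunnel_up_right_def by blast
qed

end

section \<open>Starting points and slopes of the theorem\<close>

lemma interior_triangle_subset:
  assumes "0 < s"
  shows "interior (convex hull {(0, 0), (0, 1), (1 / s, 1)})
    \<subseteq> {(x, y). 0 < x \<and> s * x < y \<and> y < (1 :: real)}"
proof -
  let ?T = "convex hull {(0 :: real, 0 :: real), (0, 1), (1 / s, 1)}"
  have half: "a \<bullet> p < c" if "p \<in> interior ?T" "a \<noteq> 0"
    "{(0, 0), (0, 1), (1 / s, 1)} \<subseteq> {p. a \<bullet> p \<le> c}" for a p :: point and c
  proof -
    have "?T \<subseteq> {p. a \<bullet> p \<le> c}" using that(3) convex_halfspace_le by (rule hull_minimal)
    hence "interior ?T \<subseteq> {p. a \<bullet> p < c}"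
      using interior_mono interior_halfspace_le[OF that(2)] by metis
    thus ?thesis using that(1) by blast
  qed
  show ?thesis
  proof clarify
    fix x y assume p: "(x, y) \<in> interior ?T"
    show "0 < x \<and> s * x < y \<and> y < 1"
      \<comment> \<open>Outer normals of the three sides \<open>x = 0\<close>,
        \<open>y = s * x\<close> and \<open>y = 1\<close>.\<close>
      using half[OF p, of "(-1, 0)" 0] half[OF p, of "(s, -1)" 0] half[OF p, of "(0, 1)" 1] assms
      by (auto simp: zero_prod_def)
  qed
qed

text \<open>The recurrence doubles solutions of the Pell equation \<open>b\<^sup>2 - 3 a\<^sup>2 = 1\<close>.\<close>

lemma slopes_pell:
  fixes s :: "nat \<Rightarrow> real"
  assumes "s 1 = 3" and rec: "\<And>n. n \<ge> 1 \<Longrightarrow> s (n + 1) = 6 * (s n)\<^sup>2 - 8 * s n + 3"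
    and "n \<ge> 1"
  shows "\<exists>S a b :: nat. s n = real S \<and> S = 2 * a\<^sup>2 + 1 \<and> 3 * S = 2 * b\<^sup>2 + 1 \<and> S mod 5 = 3"
  using assms(3)
proof (induction n rule: dec_induct)
  case base
  show ?case using assms(1) by (intro exI[of _ 3] exI[of _ 1] exI[of _ 2]) simp
next
  case (step n)
  then obtain S a b :: nat where IH: "s n = real S" "S = 2 * a\<^sup>2 + 1" "3 * S = 2 * b\<^sup>2 + 1" "S mod 5 = 3"
    by blast
  have b: "b\<^sup>2 = 3 * a\<^sup>2 + 1" using IH(2,3) by simp
  \<comment> \<open>Squaring \<open>b + a * sqrt 3\<close> gives the new Pell pair:
    \<open>2 * a * b\<close> as coefficient of the root and
    \<open>b\<^sup>2 + 3 * a\<^sup>2 = 6 * a\<^sup>2 + 1\<close> as rational part.\<close>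
  define S' where "S' = 2 * (2 * a * b)\<^sup>2 + 1"
  have S': "S' = 24 * a ^ 4 + 8 * a\<^sup>2 + 1"
  proof -
    have "S' = 8 * a\<^sup>2 * b\<^sup>2 + 1" by (simp add: S'_def power_mult_distrib)
    thus ?thesis unfolding b by (simp add: algebra_simps power4_eq_xxxx power2_eq_square)
  qed
  have "real S' = 6 * (real S)\<^sup>2 - 8 * real S + 3"
    unfolding S' IH(2) by (simp add: algebra_simps power4_eq_xxxx power2_eq_square)
  hence "s (Suc n) = real S'" using rec[of n] step.hyps IH(1) by simp
  moreover have "3 * S' = 2 * (6 * a\<^sup>2 + 1)\<^sup>2 + 1"
    unfolding S' by (simp add: algebra_simps power4_eq_xxxx power2_eq_square)
  moreover have "S' mod 5 = 3"
  proof -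
    define X where "X = S\<^sup>2"
    have X5: "X mod 5 = 4"
    proof -
      have "X mod 5 = (S mod 5)\<^sup>2 mod 5" unfolding X_def by (simp only: power_mod)
      thus ?thesis unfolding IH(4) by simp
    qed
    \<comment> \<open>The recurrence without subtraction, as needed in \<open>nat\<close>; with
      residues 3 for \<open>S\<close> and 4 for \<open>X\<close> it yields residue 3 again.\<close>
    have "S' + 8 * S = 6 * X + 3"
      unfolding X_def S' IH(2) by (simp add: algebra_simps power4_eq_xxxx power2_eq_square)
    moreover have "S = 5 * (S div 5) + 3" "X = 5 * (X div 5) + 4"
      using IH(4) X5 div_mult_mod_eq[of S 5] div_mult_mod_eq[of X 5] by linarith+
    ultimately have "S' + 5 * (8 * (S div 5)) = 3 + 5 * (6 * (X div 5))" by linarith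
    hence "(S' + 5 * (8 * (S div 5))) mod 5 = (3 + 5 * (6 * (X div 5))) mod 5" by simp
    thus ?thesis by (simp only: mod_mult_self2) simp
  qed
  ultimately show ?case using S'_def
    by (intro exI[of _ S'] exI[of _ "2 * a * b"] exI[of _ "6 * a\<^sup>2 + 1"] conjI)
qed

theorem theorem4p5:
  fixes s :: "nat \<Rightarrow> real"
  assumes "s 1 = 3"
    and "\<And>n. n \<ge> 1 \<Longrightarrow> s (n + 1) = 6 * (s n)\<^sup>2 - 8 * s n + 3"
  shows "\<forall>n\<ge>1. \<forall>p :: real \<times> real.
    p \<in> interior (convex hull {(0, 0), (0, 1), (1 / s n, 1)}) \<or> (\<exists>y. 0 < y \<and> y < 1 \<and> p = (0, y))
    \<longrightarrow> produces_periodic_tunnel_up_right p (slope_direction (s n))"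
proof (intro allI impI)
  fix n :: nat and p :: "real \<times> real"
  assume "n \<ge> 1" and p: "p \<in> interior (convex hull {(0, 0), (0, 1), (1 / s n, 1)})
    \<or> (\<exists>y. 0 < y \<and> y < 1 \<and> p = (0, y))"
  from slopes_pell[OF assms this(1)] obtain S a b :: nat
    where S: "s n = real S" "S = 2 * a\<^sup>2 + 1" "3 * S = 2 * b\<^sup>2 + 1" "S mod 5 = 3" by blast
  obtain x y where xy: "p = (x, y)" by (cases p)
  have *: "0 \<le> x \<and> real S * x < y \<and> y < 1"
    using p interior_triangle_subset[of "real S"] S(2) unfolding xy S(1)
    by (auto simp del: of_nat_add of_nat_mult of_nat_power of_nat_Suc)
  define L where "L = (LEAST l. 2 * S < travel (Suc l))"
  have ex: "2 * S < travel (Suc (2 * S))" using double_travel[of "Suc (2 * S)"] by simp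
  have L1: "2 * S < travel (Suc L)" unfolding L_def using ex by (rule LeastI)
  have L2: "travel L \<le> 2 * S"
  proof (cases L)
    case 0
    thus ?thesis using S(2) by simp
  next
    case (Suc l)
    hence "\<not> 2 * S < travel (Suc l)" unfolding L_def by (intro not_less_Least) simp
    thus ?thesis using Suc by simp
  qed
  have "0 \<le> real S * x" using * by simp
  \<comment> \<open>The parameter \<open>u\<close> is the height at which the line of the initial
    motion, extended backwards, crosses \<open>x = 0\<close>.\<close>
  interpret tunnel_run a b S L "y - real S * x"
  proof
    show "0 < y - real S * x" "y - real S * x < 1" using * \<open>0 \<le> real S * x\<close> by linarith+
  qed fact+
  show "produces_periodic_tunnel_up_right p (slope_direction (s n))"
    unfolding xy S(1) using * by (intro produces_tunnel) auto
qed

end
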